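(* Let $h\ge 2$ and let $T_h$ be the complete binary tree of height $h$. Every layout of $T_h$ of \textsc{MinWLA} type attains the minimum value of the weighted mean edge length $\bar\ell_1$ over all Recursive Layouts of $T_h$ with cut height $g=1$.
   Context: The complete binary tree $T_h$ of height $h$ has levels $0,\dots,h-1$ (the root is on level $0$, level $d$ has $2^d$ nodes), hence $2^h-1$ nodes. A layout is a bijection $\pi$ from the nodes to $\{1,\dots,2^h-1\}$. For an edge $e=uv$ its length is $\ell_e=|\pi(u)-\pi(v)|$. If $e$ joins a node on level $d-1$ to a node on level $d$, its weight is $w_e=2^{-d}$. Let $W=\sum_e w_e$. The weighted mean edge length is $\bar\ell_1=\frac1W\sum_e w_e\ell_e$. For a node $v$, let $T_v$ denote the subtree consisting of $v$ and all its descendants. A Recursive Layout with cut height $1$ is a layout $\pi$ satisfying the following conditions. First, for every node $v$ the set $\pi(T_v)$ is a contiguous interval of integers. Second, every node $v$ with children, i.e. every $v$ for which $T_v$ has height at least $2$, has one of two types: - in-order type: $\pi(v)$ lies strictly between the intervals occupied by its two child subtrees; - pre-order type: $\pi(v)$ is an endpoint of the interval $\pi(T_v)$, so both child subtrees lie on the same side of $\pi(v)$. This type covers both pre-order and post-order placement. Either child subtree may be placed on either side. The layout is further constrained as follows: (i) if $v$ is not the root and has pre-order type, then $\pi(v)$ is the endpoint of $\pi(T_v)$ nearer to $\pi(\mathrm{parent}(v))$; (ii) if $v$ has pre-order type, both of its children have children, and the child subtree whose interval is adjacent to $\pi(v)$ has a root of in-order type, then the root of the other child subtree also has in-order type. A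 \textsc{MinWLA}-type layout is a Recursive Layout with cut height $1$ in which the root has in-order type and every other node with children has pre-order type. *)

theory Defs
  imports Complex_Main
begin

text \<open>
  A node of the complete binary tree of height \<open>h\<close> is the list of left/right
  turns leading to it from the root, so \<open>[]\<close> is the root, \<open>length v\<close> is the
  level of \<open>v\<close>, the children of \<open>v\<close> are \<open>v @ [False]\<close> and \<open>v @ [True]\<close>, and the
  parent of \<open>v \<noteq> []\<close> is \<open>butlast v\<close>. Layouts are total functions of which only the
  values on \<open>nodes h\<close> matter; positions are integers so that subtraction does
  not truncate.
\<close>

type_synonym node = "bool list"

definition nodes :: "nat \<Rightarrow> node set" where
  "nodes h = {v. length v < h}"

definition edges :: "nat \<Rightarrow> (node \<times> node) set" where
  "edges h = {(v, v @ [b]) | v b. v @ [b] \<in> nodes h}"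

definition subtree :: "nat \<Rightarrow> node \<Rightarrow> node set" where
  "subtree h v = {v @ w | w. v @ w \<in> nodes h}"

definition has_children :: "nat \<Rightarrow> node \<Rightarrow> bool" where
  "has_children h v \<longleftrightarrow> (\<forall>b. v @ [b] \<in> nodes h)"

definition layout :: "nat \<Rightarrow> (node \<Rightarrow> int) \<Rightarrow> bool" where
  "layout h \<pi> \<longleftrightarrow> bij_betw \<pi> (nodes h) {1..2 ^ h - 1}"

definition edge_length :: "(node \<Rightarrow> int) \<Rightarrow> node \<times> node \<Rightarrow> real" where
  "edge_length \<pi> e = real_of_int \<bar>\<pi> (fst e) - \<pi> (snd e)\<bar>"

definition edge_weight :: "node \<times> node \<Rightarrow> real" where
  "edge_weight e = 1 / 2 ^ length (snd e)"

definition weighted_mean_edge_length :: "nat \<Rightarrow> (node \<Rightarrow> int) \<Rightarrow> real" where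
  "weighted_mean_edge_length h \<pi> =
     (\<Sum>e\<in>edges h. edge_weight e * edge_length \<pi> e) / (\<Sum>e\<in>edges h. edge_weight e)"

definition in_order_type :: "nat \<Rightarrow> (node \<Rightarrow> int) \<Rightarrow> node \<Rightarrow> bool" where
  "in_order_type h \<pi> v \<longleftrightarrow> has_children h v \<and>
     (\<exists>b. (\<forall>x\<in>\<pi> ` subtree h (v @ [b]). x < \<pi> v) \<and>
          (\<forall>y\<in>\<pi> ` subtree h (v @ [\<not> b]). \<pi> v < y))"

definition pre_order_type :: "nat \<Rightarrow> (node \<Rightarrow> int) \<Rightarrow> node \<Rightarrow> bool" where
  "pre_order_type h \<pi> v \<longleftrightarrow> has_children h v \<and>
     (\<pi> v = Min (\<pi> ` subtree h v) \<or> \<pi> v = Max (\<pi> ` subtree h v))"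

definition at_endpoint_nearer_to :: "nat \<Rightarrow> (node \<Rightarrow> int) \<Rightarrow> node \<Rightarrow> int \<Rightarrow> bool" where
  "at_endpoint_nearer_to h \<pi> v p \<longleftrightarrow>
     (let l = Min (\<pi> ` subtree h v); r = Max (\<pi> ` subtree h v)
      in \<pi> v = l \<and> \<bar>l - p\<bar> < \<bar>r - p\<bar> \<or> \<pi> v = r \<and> \<bar>r - p\<bar> < \<bar>l - p\<bar>)"

definition adjacent_subtree :: "nat \<Rightarrow> (node \<Rightarrow> int) \<Rightarrow> node \<Rightarrow> int \<Rightarrow> bool" where
  "adjacent_subtree h \<pi> c p \<longleftrightarrow>
     Min (\<pi> ` subtree h c) = p + 1 \<or> Max (\<pi> ` subtree h c) = p - 1"

text \<open>
  The cut height is fixed to \<open>1\<close>. Every subtree occupies an interval, so in the last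
  clause exactly one child subtree of a pre-order node is adjacent to it.
\<close>

definition recursive_layout :: "nat \<Rightarrow> (node \<Rightarrow> int) \<Rightarrow> bool" where
  "recursive_layout h \<pi> \<longleftrightarrow>
     layout h \<pi> \<and>
     (\<forall>v\<in>nodes h. \<exists>l r. \<pi> ` subtree h v = {l..r}) \<and>
     (\<forall>v\<in>nodes h. has_children h v \<longrightarrow> in_order_type h \<pi> v \<or> pre_order_type h \<pi> v) \<and>
     (\<forall>v\<in>nodes h. v \<noteq> [] \<and> pre_order_type h \<pi> v \<longrightarrow>
        at_endpoint_nearer_to h \<pi> v (\<pi> (butlast v))) \<and>
     (\<forall>v\<in>nodes h. \<forall>b.
        pre_order_type h \<pi> v \<and> (\<forall>b'. has_children h (v @ [b'])) \<and>
        adjacent_subtree h \<pi> (v @ [b]) (\<pi> v) \<and> in_order_type h \<pi> (v @ [b]) \<longrightarrow>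
        in_order_type h \<pi> (v @ [\<not> b]))"

definition minwla_layout :: "nat \<Rightarrow> (node \<Rightarrow> int) \<Rightarrow> bool" where
  "minwla_layout h \<pi> \<longleftrightarrow>
     recursive_layout h \<pi> \<and> in_order_type h \<pi> [] \<and>
     (\<forall>v\<in>nodes h. v \<noteq> [] \<and> has_children h v \<longrightarrow> pre_order_type h \<pi> v)"

end

theory Submission
  imports Defs
begin

text \<open>
  The length of the edge from \<open>v\<close> to its child \<open>c\<close> is the distance from \<open>v\<close> to the interval of
  \<open>T\<^sub>c\<close> plus the distance from the near end of that interval to \<open>c\<close>. Charge the first part to \<open>v\<close>
  and the second to \<open>c\<close>. If the child subtrees of \<open>v\<close> have \<open>s\<close> nodes each, the distances from \<open>v\<close>
  to their intervals add up to \<open>2\<close> for in-order and to \<open>s + 2\<close> for pre-order type, while \<open>v\<close> itself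
  lies at distance \<open>s\<close> or \<open>0\<close> from the end of its interval nearer to its parent. As child
  edges weigh half as much as the parent edge, every node is charged \<open>2 / 2 + s\<close> (in-order) or
  \<open>(s + 2) / 2\<close> (pre-order) times \<open>2 ^ - d\<close> on level \<open>d\<close>, except that \<open>s\<close> is dropped from the
  charge of an in-order root. So in-order is optimal at the root and pre-order everywhere else,
  independently of the types of all other nodes.
\<close>

section \<open>Integer intervals\<close>

definition gap :: "int \<Rightarrow> int set \<Rightarrow> int" where
  "gap p S = Min ((\<lambda>x. \<bar>p - x\<bar>) ` S)"

lemma gap_below_interval:
  assumes "p \<le> l" and "l < r"
  shows "gap p {l..<r} = l - p"
  unfolding gap_def using assms by (intro Min_eqI) (auto intro: rev_image_eqI[of l])

lemma gap_above_interval: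
  assumes "r \<le> p" and "l < r"
  shows "gap p {l..<r} = p - r + 1"
  unfolding gap_def using assms by (intro Min_eqI) (auto intro: rev_image_eqI[of "r - 1"])

lemma Min_atLeastLessThan_int: "l < r \<Longrightarrow> Min {l..<r} = l" for l r :: int
  by (intro Min_eqI) auto

lemma Max_atLeastLessThan_int: "l < r \<Longrightarrow> Max {l..<r} = r - 1" for l r :: int
  by (intro Max_eqI) auto

lemma atLeastLessThan_Un_disjoint_adjacent:
  fixes a b c d l r :: "'a :: linorder"
  assumes union: "{a..<b} \<union> {c..<d} = {l..<r}" and disjoint: "{a..<b} \<inter> {c..<d} = {}"
    and nonempty: "a < b" "c < d" and least: "l \<in> {a..<b}"
  shows "a = l \<and> b = c \<and> d = r"
proof -
  have mem: "x \<in> {l..<r} \<longleftrightarrow> a \<le> x \<and> x < b \<or> c \<le> x \<and> x < d" for x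
    unfolding union[symmetric] by auto
  have "a = l"
    using mem[of a] nonempty least by auto
  moreover have "b \<le> c"
    using mem[of c] \<open>a = l\<close> nonempty disjoint by (auto simp: disjoint_iff)
  moreover have "\<not> b < c"
    using mem[of b] mem[of c] \<open>a = l\<close> nonempty by auto
  moreover have "d = r"
    using mem[of d] mem[of r] mem[of c] \<open>a = l\<close> \<open>b \<le> c\<close> nonempty by auto
  ultimately show ?thesis by auto
qed

lemma atLeastLessThan_Un_disjoint_cases:
  fixes a b c d l r :: "'a :: linorder"
  assumes union: "{a..<b} \<union> {c..<d} = {l..<r}" and disjoint: "{a..<b} \<inter> {c..<d} = {}"
    and nonempty: "a < b" "c < d"
  shows "a = l \<and> b = c \<and> d = r \<or> c = l \<and> d = a \<and> b = r"
proof -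
  have "a \<in> {l..<r}"
    using union nonempty by auto
  then consider "l \<in> {a..<b}" | "l \<in> {c..<d}"
    using union by fastforce
  then show ?thesis
  proof cases
    assume "l \<in> {a..<b}"
    then show ?thesis
      using atLeastLessThan_Un_disjoint_adjacent[OF union disjoint nonempty] by blast
  next
    assume "l \<in> {c..<d}"
    then show ?thesis
      using atLeastLessThan_Un_disjoint_adjacent[of c d a b] union disjoint nonempty
      by (simp add: Un_commute Int_commute)
  qed
qed

lemma atLeastLessThan_eq_insert_split:
  fixes p l r :: "'a :: linorder"
  assumes "{l..<r} = insert p (A \<union> B)"
    and "\<And>x. x \<in> A \<Longrightarrow> x < p" and "\<And>x. x \<in> B \<Longrightarrow> p < x"
  shows "A = {l..<p}" and "B = {p<..<r}"
proof -
  have "A = {l..<r} \<inter> {..<p}" "B = {l..<r} \<inter> {p<..}"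
    using assms(2,3) unfolding assms(1) by (auto dest: order.asym)
  moreover have "p \<in> {l..<r}"
    using assms(1) by blast
  ultimately show "A = {l..<p}" "B = {p<..<r}" by auto
qed

section \<open>Subtrees of the complete binary tree\<close>

definition child_size :: "nat \<Rightarrow> node \<Rightarrow> int" where
  "child_size h v = 2 ^ (h - length v - 1) - 1"

lemma has_children_iff: "has_children h v \<longleftrightarrow> Suc (length v) < h"
  by (simp add: has_children_def nodes_def)

lemma child_in_nodes: "has_children h v \<Longrightarrow> v @ [b] \<in> nodes h"
  by (simp add: has_children_def)

lemma has_children_imp_node: "has_children h v \<Longrightarrow> v \<in> nodes h"
  by (simp add: has_children_iff nodes_def)

lemma nodes_Suc: "nodes (Suc n) = {v. set v \<subseteq> UNIV \<and> length v \<le> n}"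
  by (auto simp: nodes_def)

lemma finite_nodes: "finite (nodes h)"
proof (cases h)
  case (Suc n)
  show ?thesis
    unfolding Suc nodes_Suc by (rule finite_lists_length_le) simp
qed (simp add: nodes_def)

lemma card_nodes: "card (nodes h) = 2 ^ h - 1"
proof (cases h)
  case (Suc n)
  have "card (nodes h) = (\<Sum>i\<le>n. 2 ^ i)"
    unfolding Suc nodes_Suc by (subst card_lists_length_le) simp_all
  also have "\<dots> = (\<Sum>i = 0..<h. 2 ^ i)"
    by (simp only: Suc atLeast0LessThan lessThan_Suc_atMost)
  finally show ?thesis
    by (simp add: sum_power2)
qed (simp add: nodes_def)

lemma card_subtree: "card (subtree h v) = 2 ^ (h - length v) - 1"
proof -
  have "subtree h v = (@) v ` nodes (h - length v)"
    by (auto simp: subtree_def nodes_def)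
  then show ?thesis
    by (simp add: card_image inj_on_def card_nodes)
qed

lemma child_size_nonneg: "0 \<le> child_size h v"
  by (simp add: child_size_def)

lemma child_size_pos:
  assumes "has_children h v"
  shows "0 < child_size h v"
  using assms by (simp add: child_size_def has_children_iff)

lemma child_size_child:
  assumes "has_children h v"
  shows "child_size h v = 2 * child_size h (v @ [b]) + 1"
proof -
  have "h - length v - 1 = Suc (h - length (v @ [b]) - 1)"
    using assms by (simp add: has_children_iff)
  then show ?thesis
    by (simp add: child_size_def)
qed

lemma card_subtree_eq_child_size:
  assumes "v \<in> nodes h"
  shows "int (card (subtree h v)) = 2 * child_size h v + 1"
proof -
  have "h - length v = Suc (h - length v - 1)"
    using assms by (simp add: nodes_def)
  then have "(2::int) ^ (h - length v) = 2 * 2 ^ (h - length v - 1)"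
    by (metis power_Suc)
  then show ?thesis
    by (simp add: card_subtree child_size_def of_nat_diff)
qed

lemma subtree_subset_nodes: "subtree h v \<subseteq> nodes h"
  by (auto simp: subtree_def)

lemma subtree_eq_insert_children:
  assumes "v \<in> nodes h"
  shows "subtree h v = insert v (subtree h (v @ [b]) \<union> subtree h (v @ [\<not> b]))"
proof (intro equalityI subsetI)
  fix u assume "u \<in> subtree h v"
  then obtain w where w: "u = v @ w" "u \<in> nodes h"
    by (auto simp: subtree_def)
  show "u \<in> insert v (subtree h (v @ [b]) \<union> subtree h (v @ [\<not> b]))"
    using w by (cases w; cases "hd w = b") (auto simp: subtree_def)
qed (use assms in \<open>auto simp: subtree_def\<close>)

lemma root_in_subtree: "v \<in> nodes h \<Longrightarrow> v \<in> subtree h v"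
  by (auto simp: subtree_def)

lemma root_notin_child_subtree: "v \<notin> subtree h (v @ [b])"
  by (auto simp: subtree_def)

lemma child_subtrees_disjoint: "subtree h (v @ [b]) \<inter> subtree h (v @ [\<not> b]) = {}"
  by (auto simp: subtree_def)

section \<open>Charging edge lengths to nodes\<close>

definition child_gaps :: "nat \<Rightarrow> (node \<Rightarrow> int) \<Rightarrow> node \<Rightarrow> int" where
  "child_gaps h \<sigma> v = (\<Sum>b\<in>UNIV. gap (\<sigma> v) (\<sigma> ` subtree h (v @ [b])))"

lemma child_gaps_eq:
  "child_gaps h \<sigma> v =
    gap (\<sigma> v) (\<sigma> ` subtree h (v @ [b])) + gap (\<sigma> v) (\<sigma> ` subtree h (v @ [\<not> b]))"
  by (cases b) (simp_all add: child_gaps_def UNIV_bool)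

definition entry_offset :: "nat \<Rightarrow> (node \<Rightarrow> int) \<Rightarrow> node \<Rightarrow> int" where
  "entry_offset h \<sigma> v =
     \<bar>\<sigma> (butlast v) - \<sigma> v\<bar> - gap (\<sigma> (butlast v)) (\<sigma> ` subtree h v)"

text \<open>
  The case distinctions exclude two junk values: for a leaf, \<open>child_gaps\<close> consists of gaps to
  the empty set, and for the root, \<open>entry_offset\<close> refers to \<open>butlast [] = []\<close>.
\<close>

definition node_cost :: "nat \<Rightarrow> (node \<Rightarrow> int) \<Rightarrow> node \<Rightarrow> real" where
  "node_cost h \<sigma> v =
     ((if has_children h v then child_gaps h \<sigma> v / 2 else 0) +
      (if v \<noteq> [] then entry_offset h \<sigma> v else 0)) / 2 ^ length v"

lemma sum_edges_eq_sum_nonroot: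
  "sum f (edges h) = (\<Sum>v | v \<in> nodes h \<and> v \<noteq> []. f (butlast v, v))"
proof (rule sum.reindex_bij_witness[where i = "\<lambda>v. (butlast v, v)" and j = snd])
  fix v assume "v \<in> {v. v \<in> nodes h \<and> v \<noteq> []}"
  then show "(butlast v, v) \<in> edges h"
    by (cases v rule: rev_cases) (auto simp: edges_def)
qed (auto simp: edges_def)

lemma sum_nonroot_eq_sum_children:
  "(\<Sum>v | v \<in> nodes h \<and> v \<noteq> []. f v) =
    (\<Sum>v | v \<in> nodes h \<and> has_children h v. \<Sum>b\<in>UNIV. f (v @ [b]))"
proof -
  have "(\<Sum>v | v \<in> nodes h \<and> v \<noteq> []. f v) =
      (\<Sum>(v, b)\<in>{v \<in> nodes h. has_children h v} \<times> UNIV. f (v @ [b]))"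
    by (rule sum.reindex_bij_witness
        [where i = "\<lambda>(v, b). v @ [b]" and j = "\<lambda>v. (butlast v, last v)"])
      (auto simp: nodes_def has_children_iff less_diff_conv)
  then show ?thesis
    by (simp add: sum.cartesian_product)
qed

lemma sum_weighted_edge_length_eq_sum_node_cost:
  "(\<Sum>e\<in>edges h. edge_weight e * edge_length \<sigma> e) = (\<Sum>v\<in>nodes h. node_cost h \<sigma> v)"
proof -
  let ?gap = "\<lambda>v. gap (\<sigma> (butlast v)) (\<sigma> ` subtree h v) / 2 ^ length v :: real"
  let ?offset = "\<lambda>v. entry_offset h \<sigma> v / 2 ^ length v :: real"
  have "(\<Sum>e\<in>edges h. edge_weight e * edge_length \<sigma> e) =
      (\<Sum>v | v \<in> nodes h \<and> v \<noteq> []. ?gap v + ?offset v)"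
    unfolding sum_edges_eq_sum_nonroot
    by (intro sum.cong) (auto simp: edge_weight_def edge_length_def entry_offset_def field_simps)
  also have "\<dots> = (\<Sum>v | v \<in> nodes h \<and> has_children h v. \<Sum>b\<in>UNIV. ?gap (v @ [b])) +
      (\<Sum>v | v \<in> nodes h \<and> v \<noteq> []. ?offset v)"
    by (simp only: sum.distrib sum_nonroot_eq_sum_children[of ?gap])
  also have "\<dots> = (\<Sum>v | v \<in> nodes h \<and> has_children h v. child_gaps h \<sigma> v / 2 / 2 ^ length v) +
      (\<Sum>v | v \<in> nodes h \<and> v \<noteq> []. ?offset v)"
    by (simp add: child_gaps_def sum_divide_distrib)
  also have "\<dots> = (\<Sum>v\<in>nodes h. node_cost h \<sigma> v)"
    unfolding sum.inter_filter[OF finite_nodes] sum.distrib[symmetric]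
    by (intro sum.cong) (auto simp: node_cost_def add_divide_distrib)
  finally show ?thesis .
qed

section \<open>Layouts with contiguous subtrees\<close>

locale contiguous_layout =
  fixes h :: nat and \<sigma> :: "node \<Rightarrow> int"
  assumes inj_on_nodes: "inj_on \<sigma> (nodes h)"
    and subtree_contiguous: "v \<in> nodes h \<Longrightarrow> \<exists>l r. \<sigma> ` subtree h v = {l..r}"
begin

lemma subtree_interval:
  assumes "v \<in> nodes h"
  obtains l where "\<sigma> ` subtree h v = {l..<l + 2 * child_size h v + 1}"
proof -
  obtain l r where interval: "\<sigma> ` subtree h v = {l..r}"
    using subtree_contiguous[OF assms] by blast
  have "card (\<sigma> ` subtree h v) = card (subtree h v)"
    by (rule card_image[OF inj_on_subset[OF inj_on_nodes subtree_subset_nodes]])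
  then have "int (nat (r - l + 1)) = 2 * child_size h v + 1"
    unfolding interval card_subtree_eq_child_size[OF assms, symmetric] by simp
  then have "r = l + 2 * child_size h v"
    using child_size_nonneg[of h v] by linarith
  then show thesis
    using that interval by (auto simp: atLeastLessThanPlusOne_atLeastAtMost_int)
qed

lemma child_subtree_interval:
  assumes "has_children h v"
  obtains l where "\<sigma> ` subtree h (v @ [b]) = {l..<l + child_size h v}"
proof -
  obtain l where "\<sigma> ` subtree h (v @ [b]) = {l..<l + 2 * child_size h (v @ [b]) + 1}"
    using subtree_interval[OF child_in_nodes[OF assms]] .
  then show thesis
    using that child_size_child[OF assms, of b] by (simp add: add.assoc)
qed

lemma image_subtree_eq_insert_children:
  assumes "v \<in> nodes h"
  shows "\<sigma> ` subtree h v =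
    insert (\<sigma> v) (\<sigma> ` subtree h (v @ [b]) \<union> \<sigma> ` subtree h (v @ [\<not> b]))"
  by (subst subtree_eq_insert_children[OF assms, of b]) auto

lemma position_notin_child_image: "v \<in> nodes h \<Longrightarrow> \<sigma> v \<notin> \<sigma> ` subtree h (v @ [b])"
  using inj_on_image_mem_iff[OF inj_on_nodes _ subtree_subset_nodes] root_notin_child_subtree
  by blast

lemma child_images_disjoint: "\<sigma> ` subtree h (v @ [b]) \<inter> \<sigma> ` subtree h (v @ [\<not> b]) = {}"
  by (subst inj_on_image_Int[OF inj_on_nodes, symmetric])
    (simp_all add: subtree_subset_nodes child_subtrees_disjoint)

lemma in_order_intervals:
  assumes "in_order_type h \<sigma> v"
  obtains l b where "\<sigma> v = l + child_size h v"
    and "\<sigma> ` subtree h v = {l..<l + 2 * child_size h v + 1}"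
    and "\<sigma> ` subtree h (v @ [b]) = {l..<\<sigma> v}"
    and "\<sigma> ` subtree h (v @ [\<not> b]) = {\<sigma> v + 1..<l + 2 * child_size h v + 1}"
proof -
  obtain b where children: "has_children h v"
    and below: "\<And>x. x \<in> \<sigma> ` subtree h (v @ [b]) \<Longrightarrow> x < \<sigma> v"
    and above: "\<And>x. x \<in> \<sigma> ` subtree h (v @ [\<not> b]) \<Longrightarrow> \<sigma> v < x"
    using assms by (auto simp: in_order_type_def)
  have node: "v \<in> nodes h"
    using children by (rule has_children_imp_node)
  obtain l where interval: "\<sigma> ` subtree h v = {l..<l + 2 * child_size h v + 1}"
    using subtree_interval[OF node] .
  note parts = image_subtree_eq_insert_children[OF node, of b, unfolded interval]
  have left: "\<sigma> ` subtree h (v @ [b]) = {l..<\<sigma> v}"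
    by (rule atLeastLessThan_eq_insert_split(1)[OF parts below above])
  have right: "\<sigma> ` subtree h (v @ [\<not> b]) = {\<sigma> v + 1..<l + 2 * child_size h v + 1}"
    unfolding atLeastPlusOneLessThan_greaterThanLessThan_int
    by (rule atLeastLessThan_eq_insert_split(2)[OF parts below above])
  obtain a where "\<sigma> ` subtree h (v @ [b]) = {a..<a + child_size h v}"
    using child_subtree_interval[OF children] .
  then have "\<sigma> v = l + child_size h v"
    using left child_size_pos[OF children] by (simp add: Ico_eq_Ico)
  then show thesis
    using that interval left right by blast
qed

lemma pre_order_children_interval:
  assumes "pre_order_type h \<sigma> v"
  obtains l where "\<sigma> v = l - 1 \<or> \<sigma> v = l + 2 * child_size h v"
    and "\<sigma> ` subtree h (v @ [False]) \<union> \<sigma> ` subtree h (v @ [True]) =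
      {l..<l + 2 * child_size h v}"
proof -
  have children: "has_children h v"
    and endpoint: "\<sigma> v = Min (\<sigma> ` subtree h v) \<or> \<sigma> v = Max (\<sigma> ` subtree h v)"
    using assms by (auto simp: pre_order_type_def)
  have node: "v \<in> nodes h"
    using children by (rule has_children_imp_node)
  obtain l where interval: "\<sigma> ` subtree h v = {l..<l + 2 * child_size h v + 1}"
    using subtree_interval[OF node] .
  have rest: "\<sigma> ` subtree h (v @ [False]) \<union> \<sigma> ` subtree h (v @ [True]) =
      {l..<l + 2 * child_size h v + 1} - {\<sigma> v}"
    using image_subtree_eq_insert_children[OF node, of False] position_notin_child_image[OF node]
    unfolding interval by auto
  consider "\<sigma> v = l" | "\<sigma> v = l + 2 * child_size h v"
    using endpoint child_size_pos[OF children] unfolding interval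
    by (auto simp: Min_atLeastLessThan_int Max_atLeastLessThan_int)
  then show thesis
  proof cases
    assume "\<sigma> v = l"
    then show thesis
      by (intro that[of "l + 1"]) (auto simp: rest)
  next
    assume "\<sigma> v = l + 2 * child_size h v"
    then show thesis
      by (intro that[of l]) (auto simp: rest)
  qed
qed

lemma pre_order_intervals:
  assumes "pre_order_type h \<sigma> v"
  obtains l b where "\<sigma> v = l - 1 \<or> \<sigma> v = l + 2 * child_size h v"
    and "\<sigma> ` subtree h (v @ [b]) = {l..<l + child_size h v}"
    and "\<sigma> ` subtree h (v @ [\<not> b]) = {l + child_size h v..<l + 2 * child_size h v}"
proof -
  have children: "has_children h v"
    using assms by (simp add: pre_order_type_def)
  have "\<exists>m. \<sigma> ` subtree h (v @ [b]) = {m..<m + child_size h v}" for b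
    by (rule child_subtree_interval[OF children]) (rule exI)
  then obtain a where a: "\<And>b. \<sigma> ` subtree h (v @ [b]) = {a b..<a b + child_size h v}"
    by metis
  obtain l where position: "\<sigma> v = l - 1 \<or> \<sigma> v = l + 2 * child_size h v"
    and union: "{a False..<a False + child_size h v} \<union> {a True..<a True + child_size h v} =
      {l..<l + 2 * child_size h v}"
    using pre_order_children_interval[OF assms] unfolding a .
  have disjoint: "{a False..<a False + child_size h v} \<inter> {a True..<a True + child_size h v} = {}"
    using child_images_disjoint[of v False] unfolding a by simp
  have nonempty: "a b < a b + child_size h v" for b
    using child_size_pos[OF children] by simp
  consider (False_first) "a False = l" "a True = l + child_size h v"
    | (True_first) "a True = l" "a False = l + child_size h v"
    using atLeastLessThan_Un_disjoint_cases[OF union disjoint nonempty nonempty] by metis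
  then show thesis
  proof cases
    case False_first
    then show thesis
      using that[OF position, of False] a[of False] a[of True] by (simp add: add.assoc)
  next
    case True_first
    then show thesis
      using that[OF position, of True] a[of False] a[of True] by (simp add: add.assoc)
  qed
qed

lemma child_gaps_in_order:
  assumes "in_order_type h \<sigma> v"
  shows "child_gaps h \<sigma> v = 2"
proof -
  have size: "0 < child_size h v"
    using assms by (auto simp: in_order_type_def intro: child_size_pos)
  obtain l b where position: "\<sigma> v = l + child_size h v"
    and left: "\<sigma> ` subtree h (v @ [b]) = {l..<\<sigma> v}"
    and right: "\<sigma> ` subtree h (v @ [\<not> b]) = {\<sigma> v + 1..<l + 2 * child_size h v + 1}"
    using in_order_intervals[OF assms] .
  have "gap (\<sigma> v) (\<sigma> ` subtree h (v @ [b])) = 1"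
    unfolding left using position size by (simp add: gap_above_interval)
  moreover have "gap (\<sigma> v) (\<sigma> ` subtree h (v @ [\<not> b])) = 1"
    unfolding right using position size by (simp add: gap_below_interval)
  ultimately show ?thesis
    by (simp add: child_gaps_eq[of _ _ _ b])
qed

lemma child_gaps_pre_order:
  assumes "pre_order_type h \<sigma> v"
  shows "child_gaps h \<sigma> v = child_size h v + 2"
proof -
  have size: "0 < child_size h v"
    using assms by (auto simp: pre_order_type_def intro: child_size_pos)
  obtain l b where position: "\<sigma> v = l - 1 \<or> \<sigma> v = l + 2 * child_size h v"
    and left: "\<sigma> ` subtree h (v @ [b]) = {l..<l + child_size h v}"
    and right: "\<sigma> ` subtree h (v @ [\<not> b]) = {l + child_size h v..<l + 2 * child_size h v}"
    using pre_order_intervals[OF assms] .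
  show ?thesis
    using position size
    by (auto simp: child_gaps_eq[of _ _ _ b] left right gap_above_interval gap_below_interval)
qed

lemma parent_position_cases:
  assumes "v \<in> nodes h" and "v \<noteq> []" and "\<sigma> ` subtree h v = {l..<r}"
  shows "\<sigma> (butlast v) < l \<or> r \<le> \<sigma> (butlast v)"
proof -
  have "butlast v \<in> nodes h"
    using assms(1) by (simp add: nodes_def)
  then have "\<sigma> (butlast v) \<notin> \<sigma> ` subtree h (butlast v @ [last v])"
    by (rule position_notin_child_image)
  then show ?thesis
    using assms by auto
qed

lemma entry_offset_cases:
  assumes "v \<in> nodes h" and "v \<noteq> []" and interval: "\<sigma> ` subtree h v = {l..<r}"
  obtains "\<sigma> (butlast v) < l" "entry_offset h \<sigma> v = \<sigma> v - l"
    | "r \<le> \<sigma> (butlast v)" "entry_offset h \<sigma> v = r - 1 - \<sigma> v"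
proof -
  have "\<sigma> v \<in> {l..<r}"
    using root_in_subtree[OF assms(1)] interval by blast
  then show thesis
    using that parent_position_cases[OF assms]
    by (auto simp: entry_offset_def interval gap_above_interval gap_below_interval)
qed

lemma entry_offset_in_order:
  assumes "in_order_type h \<sigma> v" and "v \<noteq> []"
  shows "entry_offset h \<sigma> v = child_size h v"
proof -
  have node: "v \<in> nodes h"
    using assms(1) by (simp add: in_order_type_def has_children_imp_node)
  obtain l where "\<sigma> v = l + child_size h v"
    and interval: "\<sigma> ` subtree h v = {l..<l + 2 * child_size h v + 1}"
    using in_order_intervals[OF assms(1)] .
  then show ?thesis
    using entry_offset_cases[OF node assms(2) interval] by fastforce
qed

lemma entry_offset_near_endpoint:
  assumes node: "v \<in> nodes h" and "v \<noteq> []"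
    and near: "at_endpoint_nearer_to h \<sigma> v (\<sigma> (butlast v))"
  shows "entry_offset h \<sigma> v = 0"
proof -
  obtain l where interval: "\<sigma> ` subtree h v = {l..<l + 2 * child_size h v + 1}"
    using subtree_interval[OF node] .
  show ?thesis
    using near child_size_nonneg[of h v] unfolding at_endpoint_nearer_to_def interval
    by (cases rule: entry_offset_cases[OF node assms(2) interval])
      (auto simp: Let_def Min_atLeastLessThan_int Max_atLeastLessThan_int)
qed

lemma entry_offset_leaf:
  assumes node: "v \<in> nodes h" and "v \<noteq> []" and "\<not> has_children h v"
  shows "entry_offset h \<sigma> v = 0"
proof -
  have "child_size h v = 0"
    using assms by (simp add: child_size_def has_children_iff nodes_def)
  then obtain l where interval: "\<sigma> ` subtree h v = {l..<l + 1}"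
    using subtree_interval[OF node] by auto
  then have "\<sigma> v = l"
    using root_in_subtree[OF node] by force
  then show ?thesis
    using entry_offset_cases[OF node assms(2) interval] by fastforce
qed

lemma node_cost_in_order:
  assumes "in_order_type h \<sigma> v"
  shows "node_cost h \<sigma> v = (if v = [] then 1 else child_size h v + 1) / 2 ^ length v"
  using assms child_gaps_in_order entry_offset_in_order
  by (simp add: node_cost_def in_order_type_def)

lemma node_cost_pre_order:
  assumes "pre_order_type h \<sigma> v"
    and "v \<noteq> [] \<Longrightarrow> at_endpoint_nearer_to h \<sigma> v (\<sigma> (butlast v))"
  shows "node_cost h \<sigma> v = (child_size h v / 2 + 1) / 2 ^ length v"
  using assms child_gaps_pre_order entry_offset_near_endpoint
  by (auto simp: node_cost_def pre_order_type_def has_children_imp_node add_divide_distrib)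

lemma node_cost_leaf:
  assumes "v \<in> nodes h" and "\<not> has_children h v"
  shows "node_cost h \<sigma> v = 0"
  using assms by (simp add: node_cost_def entry_offset_leaf)

end

section \<open>Optimality\<close>

lemma recursive_layout_imp_contiguous_layout: "recursive_layout h \<sigma> \<Longrightarrow> contiguous_layout h \<sigma>"
  by unfold_locales (auto simp: recursive_layout_def layout_def bij_betw_def)

lemma recursive_layout_node_cost_pre_order:
  assumes "recursive_layout h \<sigma>" and "pre_order_type h \<sigma> v"
  shows "node_cost h \<sigma> v = (child_size h v / 2 + 1) / 2 ^ length v"
proof (rule contiguous_layout.node_cost_pre_order)
  show "contiguous_layout h \<sigma>"
    using assms(1) by (rule recursive_layout_imp_contiguous_layout)
  show "at_endpoint_nearer_to h \<sigma> v (\<sigma> (butlast v))" if "v \<noteq> []"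
    using assms that
    by (auto simp: recursive_layout_def pre_order_type_def has_children_imp_node)
qed (rule assms(2))

lemma minwla_node_cost:
  assumes minwla: "minwla_layout h \<pi>" and children: "has_children h v"
  shows "node_cost h \<pi> v = (if v = [] then 1 else child_size h v / 2 + 1) / 2 ^ length v"
proof -
  have rec: "recursive_layout h \<pi>"
    using minwla by (simp add: minwla_layout_def)
  show ?thesis
  proof (cases "v = []")
    case True
    moreover have "in_order_type h \<pi> []"
      using minwla by (simp add: minwla_layout_def)
    ultimately show ?thesis
      using contiguous_layout.node_cost_in_order[OF recursive_layout_imp_contiguous_layout[OF rec]]
      by simp
  next
    case False
    then have "pre_order_type h \<pi> v"
      using minwla children by (simp add: minwla_layout_def has_children_imp_node)
    with False show ?thesis
      using recursive_layout_node_cost_pre_order[OF rec] by simp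
  qed
qed

lemma minwla_node_cost_le:
  assumes minwla: "minwla_layout h \<pi>" and rec: "recursive_layout h \<sigma>" and node: "v \<in> nodes h"
  shows "node_cost h \<pi> v \<le> node_cost h \<sigma> v"
proof -
  interpret \<pi>: contiguous_layout h \<pi>
    using minwla by (simp add: minwla_layout_def recursive_layout_imp_contiguous_layout)
  interpret \<sigma>: contiguous_layout h \<sigma>
    using rec by (rule recursive_layout_imp_contiguous_layout)
  consider (leaf) "\<not> has_children h v" | (in_order) "in_order_type h \<sigma> v"
    | (pre_order) "pre_order_type h \<sigma> v"
    using rec node by (auto simp: recursive_layout_def)
  then show ?thesis
  proof cases
    case leaf
    then show ?thesis
      using node by (simp add: \<pi>.node_cost_leaf \<sigma>.node_cost_leaf)
  next
    case in_order
    then have "has_children h v"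
      by (simp add: in_order_type_def)
    then show ?thesis
      using child_size_nonneg[of h v] unfolding minwla_node_cost[OF minwla \<open>has_children h v\<close>]
        \<sigma>.node_cost_in_order[OF in_order] by (intro divide_right_mono) auto
  next
    case pre_order
    then have "has_children h v"
      by (simp add: pre_order_type_def)
    then show ?thesis
      using child_size_nonneg[of h v] unfolding minwla_node_cost[OF minwla \<open>has_children h v\<close>]
        recursive_layout_node_cost_pre_order[OF rec pre_order] by (intro divide_right_mono) auto
  qed
qed

theorem theorem1:
  fixes h :: nat and \<pi> :: "node \<Rightarrow> int"
  assumes "h \<ge> 2"
    and "minwla_layout h \<pi>"
  shows "recursive_layout h \<pi> \<and>
    (\<forall>\<sigma>. recursive_layout h \<sigma> \<longrightarrow>
       weighted_mean_edge_length h \<pi> \<le> weighted_mean_edge_length h \<sigma>)"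
proof (intro conjI allI impI)
  show "recursive_layout h \<pi>"
    using assms(2) by (simp add: minwla_layout_def)
  fix \<sigma> assume "recursive_layout h \<sigma>"
  then have "(\<Sum>v\<in>nodes h. node_cost h \<pi> v) \<le> (\<Sum>v\<in>nodes h. node_cost h \<sigma> v)"
    using assms(2) by (intro sum_mono minwla_node_cost_le)
  moreover have "0 \<le> (\<Sum>e\<in>edges h. edge_weight e)"
    by (simp add: edge_weight_def sum_nonneg)
  ultimately show "weighted_mean_edge_length h \<pi> \<le> weighted_mean_edge_length h \<sigma>"
    unfolding weighted_mean_edge_length_def sum_weighted_edge_length_eq_sum_node_cost
    by (rule divide_right_mono)
qed

end
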